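(* Let $X$ and $Y$ be Banach spaces such that $X^*$ and $Y$ are separable. If $X$ or $Y$ has an approximating sequence $\{S_n\}_{n=1}^\infty$ such that $\lim_n\|id-2S_n\|<3/2$ (where $id$ is the identity operator of that space), then $B(X,Y)$ (with the operator norm) has the UBCP.
   Context: $B(X,Y)$ is the space of bounded linear operators from $X$ to $Y$. Approximating sequence on a Banach space $W$: a sequence $\{S_n\}_{n=1}^\infty$ of bounded finite rank operators on $W$ converging strongly (pointwise in norm) to the identity, with $S_mS_n=S_n$ for all $n<m$ (and hence $\limsup_n\|S_n\|<\infty$). UBCP (uniform ball-covering property): a normed space $Z$ has it if there exist $r>0$, $\delta>0$ and countably many closed balls $B(z_n,r_n)$ in $Z$ whose union contains the unit sphere of $Z$, with $r_n<\|z_n\|$, $r_n\le r$ and $B(z_n,r_n)\cap B(0,\delta)=\emptyset$ for all $n$. *)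

theory Defs
  imports "HOL-Analysis.Analysis"
begin

text \<open>All spaces are real normed spaces, and the bounded operators form the type
  \<open>'a \<Rightarrow>\<^sub>L 'b\<close>, normed by the operator norm.\<close>

definition finite_rank :: "('a::real_normed_vector \<Rightarrow>\<^sub>L 'b::real_normed_vector) \<Rightarrow> bool" where
  "finite_rank T \<longleftrightarrow> (\<exists>B. finite B \<and> range (blinfun_apply T) \<subseteq> span B)"

definition approximating_sequence :: "(nat \<Rightarrow> ('a::banach \<Rightarrow>\<^sub>L 'a)) \<Rightarrow> bool" where
  "approximating_sequence S \<longleftrightarrow>
     (\<forall>n. finite_rank (S n)) \<and>
     (\<forall>x. (\<lambda>n. blinfun_apply (S n) x) \<longlonglongrightarrow> x) \<and>
     (\<forall>m n. n < m \<longrightarrow> S m o\<^sub>L S n = S n)"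

text \<open>The balls are given by a countable set of pairs (centre, radius). The set may be finite, and
  may even be empty: for the zero space the unit sphere is empty, and no closed ball of
  positive radius misses the origin.\<close>

definition ubcp :: "'a::real_normed_vector itself \<Rightarrow> bool" where
  "ubcp TYPE('a) \<longleftrightarrow>
     (\<exists>r \<delta> (F :: ('a \<times> real) set).
        0 < r \<and> 0 < \<delta> \<and> countable F \<and>
        sphere 0 1 \<subseteq> (\<Union>(z, \<rho>)\<in>F. cball z \<rho>) \<and>
        (\<forall>(z, \<rho>)\<in>F. 0 < \<rho> \<and> \<rho> < norm z \<and> \<rho> \<le> r \<and> cball z \<rho> \<inter> cball 0 \<delta> = {}))"

end

theory Submission
  imports Defs
begin

text \<open>If \<open>S n\<close> is the approximating sequence, then for \<open>T\<close> of norm one the operators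
  \<open>S n o\<^sub>L T\<close> (or \<open>T o\<^sub>L S n\<close>) converge pointwise to \<open>T\<close>, so their norms
  eventually exceed any number below one, while \<open>T\<close> lies within
  \<open>norm (id_blinfun - 2 *\<^sub>R S n) < 3/2\<close> of twice these operators, whose norms eventually exceed
  any number below two. These centres have finite rank, and the finite rank operators are the finite
  sums of operators \<open>x \<mapsto> g x *\<^sub>R y\<close>, so that the separability of the dual of the
  domain and of the codomain allows countably many centres.\<close>

subsection \<open>Finite-dimensional subspaces\<close>

text \<open>The constant is the reciprocal of the distance from \<open>b\<close> to
  \<open>S\<close>, which is positive because \<open>S\<close> is closed. Dividing
  \<open>t *\<^sub>R b + y\<close> by a nonzero \<open>t\<close> gives the difference of
  \<open>b\<close> and a point of \<open>S\<close>. So the \<open>b\<close>-coordinate is controlled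
  by the norm.\<close>

lemma coordinate_bound:
  fixes S :: "'a::real_normed_vector set"
  assumes "subspace S" "closed S" "b \<notin> S"
  obtains c where "0 < c" "\<And>t y. y \<in> S \<Longrightarrow> \<bar>t\<bar> \<le> c * norm (t *\<^sub>R b + y)"
proof
  have ne: "S \<noteq> {}"
    using assms(1) subspace_0 by blast
  define d where "d = infdist b S"
  have d: "d > 0"
    unfolding d_def using infdist_pos_not_in_closed[OF assms(2) ne assms(3)] .
  show "0 < inverse d"
    using d by simp
  fix t y assume y: "y \<in> S"
  show "\<bar>t\<bar> \<le> inverse d * norm (t *\<^sub>R b + y)"
  proof (cases "t = 0")
    case False
    have "- inverse t *\<^sub>R y \<in> S"
      using assms(1) y subspace_scale by blast
    from infdist_le[OF this, of b] have "d \<le> norm (b + inverse t *\<^sub>R y)"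
      by (simp add: d_def dist_norm)
    then have "\<bar>t\<bar> * d \<le> \<bar>t\<bar> * norm (b + inverse t *\<^sub>R y)"
      by (simp add: mult_left_mono)
    also have "\<dots> = norm (t *\<^sub>R b + y)"
      using False by (simp flip: norm_scaleR add: scaleR_add_right)
    finally show ?thesis
      using d by (simp add: field_simps)
  qed (use d in simp)
qed

text \<open>By \<open>coordinate_bound\<close> the \<open>b\<close>-coordinates of a Cauchy sequence
  are Cauchy reals. Hence the remainders in \<open>span B\<close> form a Cauchy sequence as well,
  and the two limits add up to the limit sought.\<close>

lemma complete_span_insert:
  fixes B :: "'a::real_normed_vector set"
  assumes "complete (span B)" "b \<notin> span B"
  shows "complete (span (insert b B))"
proof (rule completeI)
  fix f :: "nat \<Rightarrow> 'a"
  assume f: "\<forall>n. f n \<in> span (insert b B)" and Cf: "Cauchy f"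
  have "\<forall>n. \<exists>k. f n - k *\<^sub>R b \<in> span B"
    using f span_breakdown_eq by blast
  then obtain k where k: "\<And>n. f n - k n *\<^sub>R b \<in> span B"
    by metis
  obtain c where c: "0 < c" "\<And>t y. y \<in> span B \<Longrightarrow> \<bar>t\<bar> \<le> c * norm (t *\<^sub>R b + y)"
    using coordinate_bound[OF subspace_span complete_imp_closed[OF assms(1)] assms(2)] by blast
  \<comment> \<open>The difference of two remainders lies in \<open>span B\<close>, and adding
    \<open>(k m - k n) *\<^sub>R b\<close> to it restores \<open>f m - f n\<close>.\<close>
  have le: "\<bar>k m - k n\<bar> \<le> c * norm (f m - f n)" for m n
    using c(2)[OF span_diff[OF k[of m] k[of n]], of "k m - k n"] by (simp add: algebra_simps)
  have "Cauchy k"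
  proof (rule CauchyI)
    fix e :: real assume "e > 0"
    then obtain M where M: "\<And>m n. m \<ge> M \<Longrightarrow> n \<ge> M \<Longrightarrow> norm (f m - f n) < e / c"
      using CauchyD[OF Cf, of "e / c"] c(1) by auto
    have "norm (k m - k n) < e" if "m \<ge> M" "n \<ge> M" for m n
    proof -
      have "norm (k m - k n) \<le> c * norm (f m - f n)"
        using le by simp
      also have "\<dots> < e"
        using M[OF that] c(1) by (simp add: field_simps)
      finally show ?thesis .
    qed
    then show "\<exists>M. \<forall>m\<ge>M. \<forall>n\<ge>M. norm (k m - k n) < e"
      by blast
  qed
  then obtain l where l: "k \<longlonglongrightarrow> l"
    using Cauchy_convergent convergent_def by blast
  have kb: "(\<lambda>n. k n *\<^sub>R b) \<longlonglongrightarrow> l *\<^sub>R b"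
    by (intro tendsto_intros l)
  have "Cauchy (\<lambda>n. f n - k n *\<^sub>R b)"
  proof (rule CauchyI)
    fix e :: real assume "e > 0"
    then have "e / 2 > 0" by simp
    obtain M where M: "\<And>m n. m \<ge> M \<Longrightarrow> n \<ge> M \<Longrightarrow> norm (f m - f n) < e / 2"
      using CauchyD[OF Cf \<open>e / 2 > 0\<close>] by blast
    obtain N where N: "\<And>m n. m \<ge> N \<Longrightarrow> n \<ge> N \<Longrightarrow> norm (k m *\<^sub>R b - k n *\<^sub>R b) < e / 2"
      using CauchyD[OF LIMSEQ_imp_Cauchy[OF kb] \<open>e / 2 > 0\<close>] by blast
    have "norm ((f m - k m *\<^sub>R b) - (f n - k n *\<^sub>R b)) < e"
      if "m \<ge> max M N" "n \<ge> max M N" for m n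
    proof -
      have "norm ((f m - k m *\<^sub>R b) - (f n - k n *\<^sub>R b))
          = norm ((f m - f n) - (k m *\<^sub>R b - k n *\<^sub>R b))"
        by (simp add: algebra_simps)
      also have "\<dots> \<le> norm (f m - f n) + norm (k m *\<^sub>R b - k n *\<^sub>R b)"
        by (rule norm_triangle_ineq4)
      also have "\<dots> < e"
        using M[of m n] N[of m n] that by simp
      finally show ?thesis .
    qed
    then show "\<exists>M. \<forall>m\<ge>M. \<forall>n\<ge>M. norm ((f m - k m *\<^sub>R b) - (f n - k n *\<^sub>R b)) < e"
      by blast
  qed
  then obtain y where y: "y \<in> span B" "(\<lambda>n. f n - k n *\<^sub>R b) \<longlonglongrightarrow> y"
    using completeE[OF assms(1), of "\<lambda>n. f n - k n *\<^sub>R b"] k by blast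
  have "f \<longlonglongrightarrow> y + l *\<^sub>R b"
    using tendsto_add[OF y(2) kb] by simp
  moreover have "y + l *\<^sub>R b \<in> span (insert b B)"
    using y(1) by (auto simp: span_breakdown_eq intro!: exI[of _ l])
  ultimately show "\<exists>l\<in>span (insert b B). f \<longlonglongrightarrow> l"
    by blast
qed

lemma complete_span_finite:
  fixes B :: "'a::real_normed_vector set"
  assumes "finite B"
  shows "complete (span B)"
  using assms
proof (induction B)
  case empty
  then show ?case by (simp add: compact_imp_complete)
next
  case (insert b B)
  then show ?case
    by (metis complete_span_insert span_redundant)
qed

subsection \<open>Finite rank operators\<close>

text \<open>The elementary tensor of \<open>g\<close> and \<open>y\<close>. Written as a
  composition, it inherits joint continuity in \<open>g\<close> and \<open>y\<close> from that of
  \<open>o\<^sub>L\<close>.\<close>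

definition rank_one :: "('a::real_normed_vector \<Rightarrow>\<^sub>L real) \<Rightarrow> 'b::real_normed_vector \<Rightarrow> 'a \<Rightarrow>\<^sub>L 'b" where
  "rank_one g y = blinfun_scaleR_left y o\<^sub>L g"

lemma rank_one_apply [simp]: "rank_one g y x = g x *\<^sub>R y"
  by (simp add: rank_one_def)

lemma tendsto_rank_one:
  assumes "(g \<longlongrightarrow> g') F" "(y \<longlongrightarrow> y') F"
  shows "((\<lambda>n. rank_one (g n) (y n)) \<longlongrightarrow> rank_one g' y') F"
  unfolding rank_one_def
  by (rule bounded_bilinear.tendsto[OF bounded_bilinear_blinfun_compose
        bounded_linear.tendsto[OF bounded_linear_blinfun_scaleR_left assms(2)] assms(1)])

text \<open>The functional \<open>g\<close> is the \<open>b\<close>-coordinate of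
  \<open>R x\<close>. It is linear because this coordinate is unique, and bounded by
  \<open>coordinate_bound\<close>.\<close>

lemma split_off_rank_one:
  fixes R :: "'a::real_normed_vector \<Rightarrow>\<^sub>L 'b::real_normed_vector"
  assumes "closed (span B)" "b \<notin> span B" "range R \<subseteq> span (insert b B)"
  obtains g where "range (R - rank_one g b) \<subseteq> span B"
proof -
  have "\<forall>x. \<exists>k. R x - k *\<^sub>R b \<in> span B"
    using assms(3) span_breakdown_eq by blast
  then obtain k where k: "\<And>x. R x - k x *\<^sub>R b \<in> span B"
    by metis
  obtain c where c: "0 < c" "\<And>t y. y \<in> span B \<Longrightarrow> \<bar>t\<bar> \<le> c * norm (t *\<^sub>R b + y)"
    using coordinate_bound[OF subspace_span assms(1,2)] by blast
  \<comment> \<open>The two remainders differ by \<open>(t - s) *\<^sub>R b\<close>, which cancels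
    against \<open>(s - t) *\<^sub>R b\<close>, so the bound becomes \<open>c * 0\<close>.\<close>
  have unique: "s = t" if "v - s *\<^sub>R b \<in> span B" "v - t *\<^sub>R b \<in> span B" for v s t
    using c(2)[OF span_diff[OF that], of "s - t"] by (simp add: algebra_simps)
  have "bounded_linear k"
  proof (rule bounded_linear_intro)
    fix x y
    have "R (x + y) - (k x + k y) *\<^sub>R b \<in> span B"
      using span_add[OF k[of x] k[of y]] by (simp add: blinfun.bilinear_simps algebra_simps)
    with k show "k (x + y) = k x + k y"
      by (rule unique)
  next
    fix r x
    have "R (r *\<^sub>R x) - (r *\<^sub>R k x) *\<^sub>R b \<in> span B"
      using span_scale[OF k[of x], of r] by (simp add: blinfun.bilinear_simps algebra_simps)
    with k show "k (r *\<^sub>R x) = r *\<^sub>R k x"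
      by (rule unique)
  next
    fix x
    have "norm (k x) \<le> c * norm (R x)"
      using c(2)[OF k[of x], of "k x"] by simp
    also have "\<dots> \<le> c * (norm R * norm x)"
      using c(1) norm_blinfun by (intro mult_left_mono) auto
    finally show "norm (k x) \<le> norm x * (c * norm R)"
      by (simp add: algebra_simps)
  qed
  then have "range (R - rank_one (Blinfun k) b) \<subseteq> span B"
    using k by (auto simp: blinfun.bilinear_simps bounded_linear_Blinfun_apply)
  then show thesis
    by (rule that)
qed

text \<open>Induction on a finite set spanning the range: a vector outside the span of the others is
  removed by splitting off a rank one operator. Spans of finite sets are complete and hence closed,
  as the splitting requires.\<close>

lemma finite_rank_induct [consumes 1, case_names zero add]:
  fixes R :: "'a::real_normed_vector \<Rightarrow>\<^sub>L 'b::real_normed_vector"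
  assumes "finite_rank R"
    and zero: "P 0"
    and add: "\<And>R g y. P R \<Longrightarrow> P (R + rank_one g y)"
  shows "P R"
proof -
  obtain B where "finite B" "range R \<subseteq> span B"
    using assms(1) unfolding finite_rank_def by blast
  then show ?thesis
  proof (induction B arbitrary: R)
    case empty
    then have "R = 0"
      by (intro blinfun_eqI) auto
    with zero show ?case by simp
  next
    case (insert b B)
    show ?case
    proof (cases "b \<in> span B")
      case True
      then show ?thesis
        using insert by (simp add: span_redundant)
    next
      case False
      obtain g where "range (R - rank_one g b) \<subseteq> span B"
        using split_off_rank_one[OF complete_imp_closed[OF complete_span_finite[OF insert.hyps(1)]] False]
          insert.prems by blast
      from add[OF insert.IH[OF this], of g b] show ?thesis
        by simp
    qed
  qed
qed

lemma finite_rank_compose_left: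
  fixes S :: "'b::real_normed_vector \<Rightarrow>\<^sub>L 'c::real_normed_vector"
    and T :: "'a::real_normed_vector \<Rightarrow>\<^sub>L 'b::real_normed_vector"
  assumes "finite_rank S"
  shows "finite_rank (S o\<^sub>L T)"
proof -
  obtain B where B: "finite B" "range S \<subseteq> span B"
    using assms unfolding finite_rank_def by blast
  then have "range (S o\<^sub>L T) \<subseteq> span B"
    by auto
  with B(1) show ?thesis
    unfolding finite_rank_def by blast
qed

lemma finite_rank_compose_right:
  fixes S :: "'a::real_normed_vector \<Rightarrow>\<^sub>L 'b::real_normed_vector"
    and T :: "'b::real_normed_vector \<Rightarrow>\<^sub>L 'c::real_normed_vector"
  assumes "finite_rank S"
  shows "finite_rank (T o\<^sub>L S)"
proof -
  obtain B where B: "finite B" "range S \<subseteq> span B"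
    using assms unfolding finite_rank_def by blast
  have "linear T"
    by (simp add: blinfun.bounded_linear_right bounded_linear.linear)
  then have "range (T o\<^sub>L S) \<subseteq> span (T ` B)"
    using B(2) by (auto simp: linear_span_image)
  with B(1) show ?thesis
    unfolding finite_rank_def by blast
qed

lemma finite_rank_scaleR:
  fixes S :: "'a::real_normed_vector \<Rightarrow>\<^sub>L 'b::real_normed_vector"
  assumes "finite_rank S"
  shows "finite_rank (c *\<^sub>R S)"
proof -
  obtain B where B: "finite B" "range S \<subseteq> span B"
    using assms unfolding finite_rank_def by blast
  then have "range (c *\<^sub>R S) \<subseteq> span B"
    by (auto simp: scaleR_blinfun.rep_eq intro!: span_scale)
  with B(1) show ?thesis
    unfolding finite_rank_def by blast
qed

text \<open>The countable set consists of the finite sums of \<open>rank_one g y\<close> with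
  \<open>g\<close> and \<open>y\<close> from countable dense sets. Each rank one summand is a limit
  of such terms by \<open>tendsto_rank_one\<close>, and \<open>finite_rank_induct\<close> passes to
  sums.\<close>

lemma finite_rank_separable:
  assumes "separable_space (euclidean :: ('a::real_normed_vector \<Rightarrow>\<^sub>L real) topology)"
    and "separable_space (euclidean :: 'b::real_normed_vector topology)"
  obtains C :: "('a::real_normed_vector \<Rightarrow>\<^sub>L 'b::real_normed_vector) set"
    where "countable C" "Collect finite_rank \<subseteq> closure C"
proof -
  obtain D where D: "countable D" "closure D = (UNIV :: ('a \<Rightarrow>\<^sub>L real) set)"
    using assms(1) unfolding separable_space_def by auto
  obtain E where E: "countable E" "closure E = (UNIV :: 'b set)"
    using assms(2) unfolding separable_space_def by auto
  \<comment> \<open>Lists over a countable set are countable; the empty list gives zero and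
    prepending a pair adds one summand, matching the two cases of the induction.\<close>
  define C where "C = (\<lambda>xs. \<Sum>(g, y)\<leftarrow>xs. rank_one g y) ` lists (D \<times> E)"
  have C_add: "R + rank_one g y \<in> C" if "R \<in> C" "g \<in> D" "y \<in> E" for R g y
  proof -
    have "\<exists>xs\<in>lists (D \<times> E). R = (\<Sum>(g, y)\<leftarrow>xs. rank_one g y)"
      using that(1) unfolding C_def image_iff .
    then obtain xs where xs: "xs \<in> lists (D \<times> E)" "R = (\<Sum>(g, y)\<leftarrow>xs. rank_one g y)" ..
    have "R + rank_one g y = (\<Sum>(g, y)\<leftarrow>(g, y) # xs. rank_one g y)"
      by (simp add: xs(2) add.commute)
    moreover have "(g, y) # xs \<in> lists (D \<times> E)"
      using that(2,3) xs(1) by simp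
    ultimately show ?thesis
      unfolding C_def by (rule image_eqI)
  qed
  have "R \<in> closure C" if "finite_rank R" for R :: "'a \<Rightarrow>\<^sub>L 'b"
    using that
  proof (induction R rule: finite_rank_induct)
    case zero
    have "0 \<in> C"
      unfolding C_def by (rule image_eqI[of _ _ "[]"]) auto
    then show ?case
      using closure_subset by blast
  next
    case (add R g y)
    obtain R' where R': "\<And>n::nat. R' n \<in> C" "R' \<longlonglongrightarrow> R"
      using add by (auto simp: closure_sequential)
    obtain g' where g': "\<And>n::nat. g' n \<in> D" "g' \<longlonglongrightarrow> g"
      using D(2) closure_sequential[of g D] by auto
    obtain y' where y': "\<And>n::nat. y' n \<in> E" "y' \<longlonglongrightarrow> y"
      using E(2) closure_sequential[of y E] by auto
    have "(\<lambda>n. R' n + rank_one (g' n) (y' n)) \<longlonglongrightarrow> R + rank_one g y"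
      by (intro tendsto_add tendsto_rank_one R' g' y')
    moreover have "\<forall>n. R' n + rank_one (g' n) (y' n) \<in> C"
      using C_add R'(1) g'(1) y'(1) by blast
    ultimately show ?case
      unfolding closure_sequential by (intro exI conjI)
  qed
  moreover have "countable C"
    unfolding C_def using D(1) E(1) by simp
  ultimately show thesis
    using that by blast
qed

subsection \<open>Ball coverings\<close>

text \<open>Lower semicontinuity of the operator norm: a single vector \<open>x\<close> witnesses
  \<open>c < norm T\<close>, and convergence at that \<open>x\<close> is enough.\<close>

lemma norm_eventually_gt_of_pointwise_limit:
  fixes V :: "nat \<Rightarrow> ('a::real_normed_vector \<Rightarrow>\<^sub>L 'b::real_normed_vector)"
    and T :: "'a \<Rightarrow>\<^sub>L 'b"
  assumes "\<And>x. (\<lambda>n. V n x) \<longlonglongrightarrow> T x" "0 \<le> c" "c < norm T"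
  shows "\<forall>\<^sub>F n in sequentially. c < norm (V n)"
proof -
  obtain x where x: "c * norm x < norm (T x)"
    using norm_blinfun_bound[OF assms(2), of T] assms(3) by (meson not_le)
  have "\<forall>\<^sub>F n in sequentially. c * norm x < norm (V n x)"
    using order_tendstoD(1)[OF tendsto_norm[OF assms(1)] x] .
  then show ?thesis
  proof eventually_elim
    case (elim n)
    then have "c * norm x < norm (V n) * norm x"
      using norm_blinfun[of "V n" x] by linarith
    then show ?case
      by (simp add: mult_less_cancel_right)
  qed
qed

text \<open>The gap between \<open>q\<close> and \<open>p\<close> leaves room to move each centre
  from the closure into \<open>C\<close>, enlarge the radius a little and still keep the ball away
  from the origin.\<close>

lemma ubcpI:
  fixes C :: "'a::real_normed_vector set"
  assumes "countable C" "0 < q" "q < p"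
    and cover: "\<And>x. norm x = 1 \<Longrightarrow> \<exists>w\<in>closure C. p < norm w \<and> norm (x - w) \<le> q"
  shows "ubcp TYPE('a)"
proof -
  \<comment> \<open>With a quarter of the gap, centres of norm above
    \<open>p - e = q + 3 * e\<close> and radius \<open>q + e\<close> keep every ball at distance
    more than \<open>2 * e\<close> from the origin, hence off \<open>cball 0 e\<close>.\<close>
  define e where "e = (p - q) / 4"
  have "4 * e = p - q"
    by (simp add: e_def)
  with assms(3) have e: "e > 0" "p = q + 4 * e"
    by linarith+
  \<comment> \<open>The restriction on \<open>norm z\<close> discards the points of \<open>C\<close>
    whose ball could come too close to the origin.\<close>
  define F where "F = (\<lambda>z. (z, q + e)) ` {z\<in>C. p - e < norm z}"
  have "countable F"
    unfolding F_def using assms(1) by (simp add: countable_Collect)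
  moreover have "sphere 0 1 \<subseteq> (\<Union>(z, \<rho>)\<in>F. cball z \<rho>)"
  proof
    fix x :: 'a assume "x \<in> sphere 0 1"
    then obtain w where w: "w \<in> closure C" "p < norm w" "norm (x - w) \<le> q"
      using cover[of x] by auto
    obtain z where z: "z \<in> C" "norm (z - w) < e"
      using w(1) e(1) by (auto simp: closure_approachable dist_norm)
    have "norm (z - x) \<le> q + e"
      using norm_triangle_ineq4[of "z - w" "x - w"] z w by simp
    moreover have "p - e < norm z"
      using norm_triangle_ineq2[of w z] z w by (simp add: norm_minus_commute)
    ultimately show "x \<in> (\<Union>(z, \<rho>)\<in>F. cball z \<rho>)"
      using z(1) unfolding F_def by (auto simp: dist_norm)
  qed
  moreover have "0 < \<rho> \<and> \<rho> < norm z \<and> \<rho> \<le> q + e \<and> cball z \<rho> \<inter> cball 0 e = {}"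
    if F: "(z, \<rho>) \<in> F" for z \<rho>
  proof -
    have z: "\<rho> = q + e" "q + 3 * e < norm z"
      using F e unfolding F_def by auto
    have False if "norm (z - u) \<le> \<rho>" "norm u \<le> e" for u
      using norm_triangle_ineq2[of z u] that z e by linarith
    then show ?thesis
      using z e assms(2) by (auto simp: dist_norm)
  qed
  ultimately show ?thesis
    unfolding ubcp_def using e(1) assms(2)
    by (intro exI[of _ "q + e"] exI[of _ e] exI[of _ F]) auto
qed

text \<open>The centres are \<open>2 *\<^sub>R \<V> T n\<close>: for \<open>norm T = 1\<close> their
  norms eventually exceed any \<open>p < 2\<close>, while their distance to \<open>T\<close> is
  eventually below any \<open>q > L\<close>. Since \<open>L < 2\<close>, one can take
  \<open>q < p\<close>.\<close>

lemma ubcp_blinfun: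
  fixes \<V> :: "('a::real_normed_vector \<Rightarrow>\<^sub>L 'b::real_normed_vector) \<Rightarrow> nat \<Rightarrow> ('a \<Rightarrow>\<^sub>L 'b)"
  assumes "separable_space (euclidean :: ('a \<Rightarrow>\<^sub>L real) topology)"
    and "separable_space (euclidean :: 'b topology)"
    and "\<And>T n. finite_rank (\<V> T n)"
    and "\<And>T x. (\<lambda>n. \<V> T n x) \<longlonglongrightarrow> T x"
    and "\<And>T n. norm (T - 2 *\<^sub>R \<V> T n) \<le> d n * norm T"
    and "d \<longlonglongrightarrow> L" "L < 2"
  shows "ubcp TYPE('a \<Rightarrow>\<^sub>L 'b)"
proof -
  obtain C :: "('a \<Rightarrow>\<^sub>L 'b) set" where C: "countable C" "Collect finite_rank \<subseteq> closure C"
    using finite_rank_separable[OF assms(1,2)] by blast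
  \<comment> \<open>The maximum with \<open>0\<close> makes the radius \<open>q\<close> positive, as
    \<open>ubcpI\<close> demands.\<close>
  obtain q where q: "max L 0 < q" "q < 2"
    using dense[of "max L 0" 2] assms(7) by auto
  obtain p where p: "q < p" "p < 2"
    using dense[OF q(2)] by blast
  have "\<exists>W\<in>closure C. p < norm W \<and> norm (T - W) \<le> q" if T: "norm T = 1" for T
  proof -
    have "\<forall>\<^sub>F n in sequentially. p / 2 < norm (\<V> T n)"
      by (rule norm_eventually_gt_of_pointwise_limit[OF assms(4)]) (use T p q in auto)
    moreover have "\<forall>\<^sub>F n in sequentially. d n < q"
      using order_tendstoD(2)[OF assms(6)] q by simp
    ultimately have "\<forall>\<^sub>F n in sequentially. p / 2 < norm (\<V> T n) \<and> d n < q"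
      by eventually_elim simp
    then obtain n where n: "p / 2 < norm (\<V> T n)" "d n < q"
      using eventually_happens'[OF sequentially_bot] by blast
    show ?thesis
    proof (intro bexI[of _ "2 *\<^sub>R \<V> T n"] conjI)
      show "norm (T - 2 *\<^sub>R \<V> T n) \<le> q"
        using assms(5)[of T n] n T by simp
      show "2 *\<^sub>R \<V> T n \<in> closure C"
        using C(2) assms(3) finite_rank_scaleR by blast
    qed (use n in simp)
  qed
  then show ?thesis
    using ubcpI[OF C(1) _ p(1)] q(1) by simp
qed

theorem corollary1p5:
  assumes "separable_space (euclidean :: ('a::banach \<Rightarrow>\<^sub>L real) topology)"
    and "separable_space (euclidean :: 'b::banach topology)"
    and "(\<exists>S :: nat \<Rightarrow> ('a \<Rightarrow>\<^sub>L 'a). approximating_sequence S \<and>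
            (\<exists>L < 3/2. (\<lambda>n. norm (id_blinfun - 2 *\<^sub>R S n)) \<longlonglongrightarrow> L)) \<or>
         (\<exists>S :: nat \<Rightarrow> ('b \<Rightarrow>\<^sub>L 'b). approximating_sequence S \<and>
            (\<exists>L < 3/2. (\<lambda>n. norm (id_blinfun - 2 *\<^sub>R S n)) \<longlonglongrightarrow> L))"
  shows "ubcp TYPE('a \<Rightarrow>\<^sub>L 'b)"
  using assms(3)
proof (elim disjE exE conjE)
  fix S :: "nat \<Rightarrow> ('a \<Rightarrow>\<^sub>L 'a)" and L :: real
  assume S: "approximating_sequence S" and L: "L < 3/2"
    and lim: "(\<lambda>n. norm (id_blinfun - 2 *\<^sub>R S n)) \<longlonglongrightarrow> L"
  show ?thesis
  proof (rule ubcp_blinfun[OF assms(1,2), where \<V> = "\<lambda>T n. T o\<^sub>L S n", OF _ _ _ lim])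
    fix T :: "'a \<Rightarrow>\<^sub>L 'b" and n x
    show "finite_rank (T o\<^sub>L S n)"
      using S by (simp add: approximating_sequence_def finite_rank_compose_right)
    show "(\<lambda>n. (T o\<^sub>L S n) x) \<longlonglongrightarrow> T x"
      using S by (auto simp: approximating_sequence_def intro!: tendsto_intros)
    \<comment> \<open>Factoring out \<open>T\<close> bounds the error by a factor that does not
      depend on \<open>T\<close>.\<close>
    have "T - 2 *\<^sub>R (T o\<^sub>L S n) = T o\<^sub>L (id_blinfun - 2 *\<^sub>R S n)"
      by (intro blinfun_eqI) (simp add: blinfun.bilinear_simps)
    then show "norm (T - 2 *\<^sub>R (T o\<^sub>L S n)) \<le> norm (id_blinfun - 2 *\<^sub>R S n) * norm T"
      by (metis norm_blinfun_compose mult.commute)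
  qed (use L in simp)
next
  fix S :: "nat \<Rightarrow> ('b \<Rightarrow>\<^sub>L 'b)" and L :: real
  assume S: "approximating_sequence S" and L: "L < 3/2"
    and lim: "(\<lambda>n. norm (id_blinfun - 2 *\<^sub>R S n)) \<longlonglongrightarrow> L"
  show ?thesis
  proof (rule ubcp_blinfun[OF assms(1,2), where \<V> = "\<lambda>T n. S n o\<^sub>L T", OF _ _ _ lim])
    fix T :: "'a \<Rightarrow>\<^sub>L 'b" and n x
    show "finite_rank (S n o\<^sub>L T)"
      using S by (simp add: approximating_sequence_def finite_rank_compose_left)
    \<comment> \<open>Here the strong convergence of \<open>S\<close> is used at the point
      \<open>T x\<close>.\<close>
    show "(\<lambda>n. (S n o\<^sub>L T) x) \<longlonglongrightarrow> T x"
      using S by (simp add: approximating_sequence_def)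
    have "T - 2 *\<^sub>R (S n o\<^sub>L T) = (id_blinfun - 2 *\<^sub>R S n) o\<^sub>L T"
      by (intro blinfun_eqI) (simp add: blinfun.bilinear_simps)
    then show "norm (T - 2 *\<^sub>R (S n o\<^sub>L T)) \<le> norm (id_blinfun - 2 *\<^sub>R S n) * norm T"
      by (metis norm_blinfun_compose)
  qed (use L in simp)
qed

end
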